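(* Let $k$ be an integer with $k \ge 2$. There exists a computable integer $N_{0} = N_{0}(k)$ such that for every integer $n \ge N_{0}$ there are infinitely many polynomials $f(x) \in \mathbb{Z}[x]$ of degree $n$ with the following property: if $g(x) \in \mathbb{Z}[x]$ is $k$-free, then $L(f-g) \ge 2$.
   Context: For $h(x)=\sum_{j} c_j x^j \in \mathbb{Z}[x]$, the length is $L(h) = \sum_j |c_j|$. A polynomial in $\mathbb{Z}[x]$ is called $k$-free if it is not divisible by the $k$-th power of a non-constant polynomial irreducible over $\mathbb{Q}$ (for $k=2$ this is the notion of squarefree). *)

theory Defs
  imports "HOL-Computational_Algebra.Polynomial"
begin

definition poly_length :: "int poly \<Rightarrow> int" where
  "poly_length h = (\<Sum>j\<le>degree h. \<bar>coeff h j\<bar>)"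

text \<open>
  The divisor \<open>p\<close> is taken in \<open>\<int>[x]\<close>, but its irreducibility is required over \<open>\<rat>\<close>, so a
  non-trivial content of \<open>p\<close> is harmless.  The zero polynomial is not \<open>k\<close>-free.
\<close>

definition k_free :: "nat \<Rightarrow> int poly \<Rightarrow> bool" where
  "k_free k g \<longleftrightarrow>
     \<not> (\<exists>p :: int poly. degree p > 0 \<and> irreducible (map_poly of_int p :: rat poly) \<and> p ^ k dvd g)"

text \<open>
  \<open>general_recursive n f\<close>: \<open>f\<close>, restricted to argument lists of length \<open>n\<close>, is a total recursive
  function of \<open>n\<close> arguments in the sense of Herbrand, Goedel and Kleene.  Minimisation is
  only applied to regular functions, so that every generated function is total.  The values of
  \<open>f\<close> at lists of a length other than \<open>n\<close> carry no meaning.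
\<close>

inductive general_recursive :: "nat \<Rightarrow> (nat list \<Rightarrow> nat) \<Rightarrow> bool" where
  zero: "general_recursive n (\<lambda>xs. 0)"
| succ: "general_recursive 1 (\<lambda>xs. Suc (xs ! 0))"
| proj: "i < n \<Longrightarrow> general_recursive n (\<lambda>xs. xs ! i)"
| comp: "general_recursive (length gs) f \<Longrightarrow> \<forall>g\<in>set gs. general_recursive n g \<Longrightarrow>
           general_recursive n (\<lambda>xs. f (map (\<lambda>g. g xs) gs))"
| prim_rec: "general_recursive n g \<Longrightarrow> general_recursive (Suc (Suc n)) h \<Longrightarrow>
           general_recursive (Suc n)
             (\<lambda>xs. rec_nat (g (tl xs)) (\<lambda>y r. h (y # r # tl xs)) (hd xs))"
| minimisation: "general_recursive (Suc n) f \<Longrightarrow>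
           \<forall>xs. length xs = n \<longrightarrow> (\<exists>y. f (y # xs) = 0) \<Longrightarrow>
           general_recursive n (\<lambda>xs. LEAST y. f (y # xs) = 0)"

definition computable :: "(nat \<Rightarrow> nat) \<Rightarrow> bool" where
  "computable F \<longleftrightarrow> (\<exists>f. general_recursive 1 f \<and> (\<forall>k. F k = f [k]))"

end

theory Submission
  imports Defs "HOL-Computational_Algebra.Polynomial_Factorial"
begin

text \<open>
  If \<open>x\<^sup>k\<close> divides \<open>f\<close>, then \<open>f\<close> and all \<open>f \<plusminus> x\<^sup>j\<close> with \<open>j \<ge> k\<close> fail to be \<open>k\<close>-free, which leaves the
  \<open>2k\<close> polynomials \<open>f \<plusminus> x\<^sup>j\<close> with \<open>j < k\<close>.  Each of these is made divisible by the \<open>k\<close>-th power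
  of a polynomial of its own by the Chinese remainder theorem.  The moduli come from Euclid's
  sequence \<open>x\<close>, \<open>x + 1\<close>, \<open>x (x + 1) + 1\<close>, ..., each term being one more than the product \<open>P\<close> of the
  previous ones: these are monic and pairwise comaximal over the integers, so no denominators
  arise.  After \<open>2k\<close> steps \<open>P\<close> has degree at most \<open>4\<^sup>k\<close>, and \<open>f\<close> may be changed by any multiple
  of \<open>P\<^sup>k\<close>, whose degree is at most \<open>k 4\<^sup>k \<le> 8\<^sup>k\<close>.
\<close>

section \<open>Computability of the threshold\<close>

lemma general_recursive_comp1:
  assumes "general_recursive 1 f" "general_recursive n g"
  shows "general_recursive n (\<lambda>xs. f [g xs])"
  using general_recursive.comp[of "[g]" f n] assms by simp

lemma general_recursive_Suc:
  assumes "general_recursive n g"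
  shows "general_recursive n (\<lambda>xs. Suc (g xs))"
  using general_recursive_comp1[OF general_recursive.succ assms] by simp

lemma computable_power_8: "computable (\<lambda>k. 8 ^ k)"
proof -
  \<comment> \<open>\<open>D\<close> doubles its argument. Three doublings multiply by 8, so
    iterating them from 1 yields \<open>8 ^ k\<close>.\<close>
  define D :: "nat list \<Rightarrow> nat" where "D = (\<lambda>xs. rec_nat 0 (\<lambda>y r. Suc (Suc r)) (hd xs))"
  define E :: "nat list \<Rightarrow> nat" where "E = (\<lambda>xs. rec_nat (Suc 0) (\<lambda>y r. D [D [D [r]]]) (hd xs))"
  have proj1: "general_recursive 2 (\<lambda>xs. xs ! 1)"
    by (rule general_recursive.proj) simp
  have D: "general_recursive 1 D"
    using general_recursive.prim_rec
      [OF general_recursive.zero, of 0 "\<lambda>xs. Suc (Suc (xs ! 1))"]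
      general_recursive_Suc[OF general_recursive_Suc[OF proj1]]
    by (simp add: D_def numeral_2_eq_2)
  have "general_recursive 2 (\<lambda>xs. D [D [D [xs ! 1]]])"
    by (intro general_recursive_comp1[OF D] proj1)
  then have E: "general_recursive 1 E"
    using general_recursive.prim_rec
      [OF general_recursive_Suc[OF general_recursive.zero], of 0 "\<lambda>xs. D [D [D [xs ! 1]]]"]
    by (simp add: E_def numeral_2_eq_2)
  have D_eq: "D [m] = 2 * m" for m
    by (induction m) (simp_all add: D_def)
  have "E [k] = 8 ^ k" for k
    by (induction k) (simp_all add: E_def D_eq)
  with E show ?thesis
    unfolding computable_def by metis
qed

section \<open>Factors irreducible over the rationals\<close>

text \<open>Induction on the coefficients: a new coefficient \<open>u / v\<close> multiplies the
  common denominator by \<open>v\<close>.\<close>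

lemma rat_poly_clear_denominators:
  fixes a :: "rat poly"
  obtains c :: int and A :: "int poly"
  where "c \<noteq> 0" "map_poly of_int A = smult (of_int c) a"
proof -
  have "\<exists>c A. c \<noteq> 0 \<and> map_poly of_int A = smult (of_int c) a"
  proof (induction a)
    case 0
    show ?case by (rule exI[of _ 1], rule exI[of _ 0]) simp
  next
    case (pCons r a)
    obtain c A where cA: "c \<noteq> 0" "map_poly of_int A = smult (of_int c) a"
      using pCons.IH by blast
    obtain u v where "quotient_of r = (u, v)"
      by fastforce
    then have r: "v \<noteq> 0" "of_int v * r = of_int u"
      using quotient_of_div[of r u v] quotient_of_denom_pos[of r u v] by auto
    have "map_poly of_int (pCons (c * u) (smult v A)) = smult (of_int (v * c)) (pCons r a)"
      using cA r by (simp add: map_poly_pCons map_poly_smult mult.assoc mult.left_commute)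
    then show ?case
      using cA r by (metis mult_eq_0_iff)
  qed
  then show ?thesis using that by blast
qed

lemma of_int_poly_mult:
  "map_poly (of_int :: int \<Rightarrow> rat) (p * q) = map_poly of_int p * map_poly of_int q"
  by (rule poly_eqI) (simp add: coeff_map_poly coeff_mult)

lemma degree_of_int_poly [simp]: "degree (map_poly (of_int :: int \<Rightarrow> rat) p) = degree p"
  by (rule degree_map_poly) simp

lemma degree_primitive_part [simp]: "degree (primitive_part (p :: int poly)) = degree p"
  by (cases "p = 0") (use degree_smult_eq[of "content p" "primitive_part p"] in simp_all)

text \<open>A divisor of least positive degree is irreducible, by Gauss's lemma.\<close>

lemma exists_rat_irreducible_factor:
  fixes q :: "int poly"
  assumes "degree q > 0"
  obtains p where "p dvd q" "degree p > 0" "irreducible (map_poly of_int p :: rat poly)"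
proof -
  obtain p where p: "p dvd q" "degree p > 0"
    and min: "\<And>r. r dvd q \<Longrightarrow> degree r > 0 \<Longrightarrow> degree p \<le> degree r"
    using ex_has_least_nat[of "\<lambda>p. p dvd q \<and> degree p > 0" q degree] assms by auto
  have "irreducible (map_poly of_int p :: rat poly)"
  proof (rule irreducibleI)
    have "degree (map_poly of_int p :: rat poly) > 0"
      using p by simp
    then show "map_poly of_int p \<noteq> (0 :: rat poly)" "\<not> is_unit (map_poly of_int p :: rat poly)"
      by (auto elim!: is_unit_polyE simp del: degree_of_int_poly)
  next
    fix a b :: "rat poly"
    assume ab: "map_poly of_int p = a * b"
    obtain c A where A: "c \<noteq> 0" "map_poly of_int A = smult (of_int c) a"
      by (rule rat_poly_clear_denominators)
    obtain d B where B: "d \<noteq> 0" "map_poly of_int B = smult (of_int d) b"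
      by (rule rat_poly_clear_denominators)
    have "map_poly (of_int :: int \<Rightarrow> rat) (A * B) = map_poly of_int (smult (c * d) p)"
      using A B ab by (simp add: of_int_poly_mult map_poly_smult mult.commute)
    then have AB: "A * B = smult (c * d) p"
      by (simp add: poly_eq_iff coeff_map_poly flip: of_int_mult)
    \<comment> \<open>Taking primitive parts is multiplicative, so the cleared denominators
      \<open>c * d\<close> survive only as a sign.\<close>
    then have "primitive_part A * primitive_part B = smult (unit_factor (c * d)) (primitive_part p)"
      by (metis primitive_part_mult primitive_part_smult)
    moreover have "unit_factor (c * d) * unit_factor (c * d) = 1"
      using A B by (simp add: sgn_if)
    ultimately have "primitive_part p = smult (unit_factor (c * d)) (primitive_part A * primitive_part B)"
      by simp
    then have "p = smult (content p) (smult (unit_factor (c * d)) (primitive_part A * primitive_part B))"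
      by (metis content_times_primitive_part)
    then have "primitive_part A dvd p" "primitive_part B dvd p"
      by (metis dvd_smult dvd_triv_left, metis dvd_smult dvd_triv_right)
    then have "primitive_part A dvd q" "primitive_part B dvd q"
      using p dvd_trans by blast+
    \<comment> \<open>The degrees of \<open>a\<close> and \<open>b\<close> add up to
      \<open>degree p > 0\<close>, so they cannot both be at least \<open>degree p\<close>; one
      factor is constant.\<close>
    then have *: "degree A = 0 \<or> degree p \<le> degree A" "degree B = 0 \<or> degree p \<le> degree B"
      using min by fastforce+
    have deg: "degree A = degree a" "degree B = degree b"
      using A B degree_of_int_poly by (metis degree_smult_eq of_int_eq_0_iff)+
    have nz: "a \<noteq> 0" "b \<noteq> 0"
      using ab p degree_of_int_poly[of p] by auto
    then have "degree p = degree a + degree b"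
      using ab degree_of_int_poly[of p] by (simp add: degree_mult_eq)
    with * deg p nz show "is_unit a \<or> is_unit b"
      by (auto simp: is_unit_iff_degree)
  qed
  with p that show ?thesis by blast
qed

text \<open>Passing to an irreducible factor of \<open>q\<close> frees the later moduli from having
  to be irreducible.\<close>

lemma not_k_free_if_power_dvd:
  assumes "degree q > 0" "q ^ k dvd g"
  shows "\<not> k_free k g"
proof -
  obtain p where "p dvd q" "degree p > 0" "irreducible (map_poly of_int p :: rat poly)"
    by (rule exists_rat_irreducible_factor[OF assms(1)])
  then show ?thesis
    unfolding k_free_def using assms(2) dvd_power_same dvd_trans by blast
qed

section \<open>Simultaneous congruences\<close>

lemma diff_dvd_power_diff: "x - y dvd x ^ n - (y :: 'a :: comm_ring_1) ^ n"
  by (simp only: power_diff_sumr2 dvd_triv_left)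

text \<open>Induction on \<open>T\<close>: the new residue is imposed modulo
  \<open>(P + 1) ^ k\<close>, the old ones persist modulo \<open>P ^ k\<close>, and replacing
  \<open>P\<close> by \<open>P * (P + 1)\<close> doubles the degree.\<close>

lemma congruences_modulo_kth_powers:
  fixes T :: "int poly set"
  assumes "finite T" "k > 0"
  obtains P f where "lead_coeff P = 1" "degree P = 2 ^ card T" "[:0, 1:] dvd P" "[:0, 1:] ^ k dvd f"
    "\<And>t. t \<in> T \<Longrightarrow> \<exists>q. degree q > 0 \<and> q dvd P \<and> q ^ k dvd f - t"
proof -
  have "\<exists>P f. lead_coeff P = 1 \<and> degree P = 2 ^ card T \<and> [:0, 1:] dvd P \<and> [:0, 1:] ^ k dvd f \<and>
    (\<forall>t\<in>T. \<exists>q. degree q > 0 \<and> q dvd P \<and> q ^ k dvd f - t)"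
    using assms(1)
  proof (induction T)
    case empty
    show ?case by (rule exI[of _ "[:0, 1:]"], rule exI[of _ 0]) simp
  next
    case (insert t T)
    obtain P f where P: "lead_coeff P = 1" "degree P = 2 ^ card T" "[:0, 1:] dvd P"
      and f: "[:0, 1:] ^ k dvd f"
      and T: "\<forall>t\<in>T. \<exists>q. degree q > 0 \<and> q dvd P \<and> q ^ k dvd f - t"
      using insert.IH by blast
    \<comment> \<open>\<open>e\<close> is \<open>1\<close> modulo \<open>P\<^sup>k\<close> and \<open>0\<close> modulo \<open>(P + 1)\<^sup>k\<close>.\<close>
    define e where "e = (1 - (- P) ^ k) ^ k"
    define f' where "f' = e * f + (1 - e) * t"
    have "P ^ k dvd (- P) ^ k"
      by (simp add: dvd_power_same)
    then have "P ^ k dvd 1 - (1 - (- P) ^ k)"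
      by simp
    also have "\<dots> dvd 1 - e"
      using diff_dvd_power_diff[of 1 "1 - (- P) ^ k" k] by (simp add: e_def)
    finally have "P ^ k dvd (1 - e) * (t - f)"
      by simp
    also have "(1 - e) * (t - f) = f' - f"
      by (simp add: f'_def algebra_simps)
    finally have f'f: "P ^ k dvd f' - f" .
    \<comment> \<open>Modulo \<open>P + 1\<close> the polynomial \<open>- P\<close> is 1; this
      explains the sign in \<open>e\<close>.\<close>
    have "P + 1 dvd 1 - (- P) ^ k"
      using diff_dvd_power_diff[of 1 "- P" k] by (simp add: add.commute)
    then have "(P + 1) ^ k dvd e * (f - t)"
      by (simp add: e_def dvd_power_same)
    also have "e * (f - t) = f' - t"
      by (simp add: f'_def algebra_simps)
    finally have f't: "(P + 1) ^ k dvd f' - t" .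
    have cong: "q ^ k dvd f' - s" if "q dvd P" "q ^ k dvd f - s" for q s
    proof -
      have "q ^ k dvd (f' - f) + (f - s)"
        using that f'f by (meson dvd_add dvd_power_same dvd_trans)
      then show ?thesis by simp
    qed
    have degP: "degree P > 0"
      using P by simp
    then have deg: "degree (P + 1) = degree P"
      by (simp add: degree_add_eq_left)
    then have "lead_coeff (P + 1) = 1"
      using P degP by (simp add: coeff_1)
    then have "lead_coeff (P * (P + 1)) = 1"
      using P by (simp only: lead_coeff_mult mult_1)
    moreover have "degree (P * (P + 1)) = 2 ^ card (insert t T)"
      using P deg degP insert.hyps by (subst degree_mult_eq) auto
    moreover have "[:0, 1:] dvd P * (P + 1)"
      using P by simp
    moreover have "[:0, 1:] ^ k dvd f'"
      using cong[OF P(3), of 0] f by simp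
    moreover have "\<exists>q. degree q > 0 \<and> q dvd P * (P + 1) \<and> q ^ k dvd f' - s"
      if "s \<in> insert t T" for s
    proof (cases "s = t")
      case True
      then show ?thesis
        using f't deg degP by (intro exI[of _ "P + 1"]) simp
    next
      case False
      then show ?thesis
        using that T cong dvd_mult2 by (metis insertE)
    qed
    ultimately show ?case by blast
  qed
  then show ?thesis using that by blast
qed

text \<open>Pseudo-division scales \<open>f\<close> by a power of the leading coefficient of
  \<open>M\<close>, which is 1 here.\<close>

lemma monic_reduce:
  fixes f M :: "'a :: {comm_ring_1, semiring_1_no_zero_divisors} poly"
  assumes "lead_coeff M = 1" "degree M > 0"
  obtains r where "M dvd f - r" "degree r < degree M"
proof -
  obtain q r where qr: "pseudo_divmod f M = (q, r)"
    by fastforce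
  have M: "M \<noteq> 0"
    using assms by auto
  have "f - r = M * q"
    using pseudo_divmod(1)[OF M qr] assms by simp
  moreover have "degree r < degree M"
    using pseudo_divmod(2)[OF M qr] assms by auto
  ultimately show ?thesis
    using that[of r] by simp
qed

section \<open>Polynomials of length at most one\<close>

text \<open>A nonzero integer leading coefficient already uses up length 1, so all other
  coefficients vanish.\<close>

lemma poly_length_less_2D:
  assumes "poly_length s < 2"
  shows "s = 0 \<or> (\<exists>j. s = monom 1 j \<or> s = monom (-1) j)"
proof (cases "s = 0")
  case False
  have "poly_length s = \<bar>lead_coeff s\<bar> + (\<Sum>j<degree s. \<bar>coeff s j\<bar>)"
    by (simp add: poly_length_def lessThan_Suc_atMost[symmetric])
  moreover have "\<bar>lead_coeff s\<bar> \<ge> 1"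
    using False by (simp add: int_one_le_iff_zero_less)
  moreover have "(\<Sum>j<degree s. \<bar>coeff s j\<bar>) \<ge> 0"
    by (simp add: sum_nonneg)
  ultimately have lc: "\<bar>lead_coeff s\<bar> = 1" and "(\<Sum>j<degree s. \<bar>coeff s j\<bar>) = 0"
    using assms by linarith+
  then have "\<forall>j<degree s. coeff s j = 0"
    by (simp add: sum_nonneg_eq_0_iff)
  then have "s = monom (lead_coeff s) (degree s)"
    by (intro poly_eqI) (metis coeff_monom coeff_eq_0 linorder_neqE_nat)
  moreover have "lead_coeff s = 1 \<or> lead_coeff s = -1"
    using lc by linarith
  ultimately show ?thesis by metis
qed simp

theorem theorem1p3:
  "\<exists>N0 :: nat \<Rightarrow> nat. computable N0 \<and>
     (\<forall>k\<ge>2. \<forall>n\<ge>N0 k.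
        infinite {f :: int poly. degree f = n \<and>
                    (\<forall>g :: int poly. k_free k g \<longrightarrow> poly_length (f - g) \<ge> 2)})"
proof (intro exI[of _ "\<lambda>k. 8 ^ k"] conjI computable_power_8 allI impI)
  fix k n :: nat
  assume k: "k \<ge> 2" and n: "n \<ge> 8 ^ k"
  define T :: "int poly set" where "T = monom 1 ` {..<k} \<union> monom (-1) ` {..<k}"
  have "finite T"
    by (simp add: T_def)
  moreover have "k > 0"
    using k by simp
  ultimately obtain P f0 where P: "lead_coeff P = 1" "degree P = 2 ^ card T" "[:0, 1:] dvd P"
    and f0: "[:0, 1:] ^ k dvd f0"
    and T: "\<And>t. t \<in> T \<Longrightarrow> \<exists>q. degree q > 0 \<and> q dvd P \<and> q ^ k dvd f0 - t"
    using congruences_modulo_kth_powers[of T k] by metis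
  define M where "M = P ^ k"
  have "P \<noteq> 0"
    using P by auto
  then have M: "lead_coeff M = 1" "degree M = k * 2 ^ card T"
    using P lead_coeff_power[of P k] by (simp_all add: M_def degree_power_eq)
  then have "degree M > 0"
    using k by simp
  \<comment> \<open>The low degree of \<open>r\<close> lets a multiple of \<open>M\<close> added to
    it determine the degree of the sum.\<close>
  then obtain r where r: "M dvd f0 - r" "degree r < degree M"
    using monic_reduce M(1) by blast
  have "card T \<le> card (monom (1 :: int) ` {..<k}) + card (monom (-1 :: int) ` {..<k})"
    unfolding T_def by (rule card_Un_le)
  also have "\<dots> \<le> k + k"
    by (intro add_mono) (metis card_image_le card_lessThan finite_lessThan)+
  finally have "(2::nat) ^ card T \<le> 2 ^ (k + k)"
    by simp
  moreover have "k \<le> 2 ^ k"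
    by (simp add: less_imp_le)
  ultimately have "degree M \<le> 2 ^ k * 2 ^ (k + k)"
    unfolding M(2) by (intro mult_mono) simp_all
  also have "\<dots> = 8 ^ k"
    by (simp add: power_add flip: power_mult_distrib)
  finally have degM: "degree M \<le> n"
    using n by simp
  have good: "poly_length (f - g) \<ge> 2" if f: "M dvd f - f0" and g: "k_free k g" for f g
  proof (rule ccontr)
    assume "\<not> poly_length (f - g) \<ge> 2"
    then have s: "f - g = 0 \<or> (\<exists>j. f - g = monom 1 j \<or> f - g = monom (-1) j)"
      using poly_length_less_2D[of "f - g"] by simp
    \<comment> \<open>With \<open>s = f - g\<close>, the polynomial \<open>g = f - s\<close> is
      congruent to \<open>f0 - s\<close> modulo \<open>P ^ k\<close>, hence modulo
      \<open>q ^ k\<close>.\<close>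
    have cong: "q ^ k dvd g" if "q dvd P" "q ^ k dvd f0 - (f - g)" for q
    proof -
      have "q ^ k dvd (f - f0) + (f0 - (f - g))"
        using that f unfolding M_def by (meson dvd_add dvd_power_same dvd_trans)
      then show ?thesis by simp
    qed
    show False
    proof (cases "f - g \<in> T")
      case True
      then show False
        using T cong not_k_free_if_power_dvd g by blast
    next
      case False
      \<comment> \<open>Outside \<open>T\<close> the difference is 0 or a monomial of degree at
        least \<open>k\<close>, and the modulus \<open>x\<close> serves.\<close>
      then have "f - g = 0 \<or> (\<exists>j\<ge>k. f - g = monom 1 j \<or> f - g = monom (-1) j)"
        using s unfolding T_def by (metis UnI1 UnI2 imageI lessThan_iff not_le)
      moreover have "[:0, 1:] ^ k dvd monom c j" if "j \<ge> k" for c :: int and j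
        using that by (simp add: monom_altdef dvd_smult le_imp_power_dvd)
      ultimately have "[:0, 1:] ^ k dvd f - g"
        by auto
      then have "[:0, 1:] ^ k dvd g"
        using cong P f0 dvd_diff by blast
      then show False
        using not_k_free_if_power_dvd[of "[:0, 1:]"] g by simp
    qed
  qed
  \<comment> \<open>Each nonzero \<open>a\<close> becomes the leading coefficient of a polynomial of
    degree \<open>n\<close> in the class of \<open>f0\<close> modulo \<open>M\<close>, which gives
    infinitely many.\<close>
  define F where "F = (\<lambda>a :: int. monom a (n - degree M) * M + r)"
  have M0: "M \<noteq> 0"
    using M by auto
  have "degree (F a) = n" if "a \<noteq> 0" for a
  proof -
    have "degree (monom a (n - degree M) * M) = n"
      using that M0 degM by (simp add: degree_mult_eq degree_monom_eq)
    then show ?thesis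
      using r degM unfolding F_def by (subst degree_add_eq_left) simp_all
  qed
  moreover have "M dvd F a - f0" for a
  proof -
    have "M dvd monom a (n - degree M) * M - (f0 - r)"
      by (rule dvd_diff[OF dvd_triv_right r(1)])
    then show ?thesis
      by (simp add: F_def algebra_simps)
  qed
  ultimately have "F ` (- {0}) \<subseteq> {f. degree f = n \<and> (\<forall>g. k_free k g \<longrightarrow> poly_length (f - g) \<ge> 2)}"
    using good by auto
  moreover have "inj F"
    using M0 by (auto simp: F_def inj_def monom_eq_iff)
  then have "infinite (F ` (- {0}))"
    by (metis finite_imageD inj_on_subset subset_UNIV infinite_UNIV_int finite_compl finite.emptyI
        finite.insertI)
  ultimately show "infinite {f. degree f = n \<and> (\<forall>g. k_free k g \<longrightarrow> poly_length (f - g) \<ge> 2)}"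
    using finite_subset by blast
qed

end
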